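(* Let $a_1,a_2,a_4,a_5\in\mathbb{C}$ and $$V=a_1q_1^3+a_2q_1^2q_2+a_4q_1q_2^2+a_5q_2^3+(q_1+\mathrm{i}q_2)^2q_3 .$$ If $V$ has five simple proper Darboux points $[d_i]\in\mathbb{CP}^2$, $i=1,\dots,5$, with spectra $(\Lambda_1^{(i)},\Lambda_2^{(i)})$, then $$\sum_{i=1}^5\frac{1}{\Lambda_1^{(i)}\Lambda_2^{(i)}}=1,\qquad \sum_{i=1}^5\frac{\Lambda_1^{(i)}+\Lambda_2^{(i)}}{\Lambda_1^{(i)}\Lambda_2^{(i)}}=-4,\qquad \sum_{i=1}^5\frac{(\Lambda_1^{(i)}+\Lambda_2^{(i)})^2}{\Lambda_1^{(i)}\Lambda_2^{(i)}}=16 .$$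
   Context: For a homogeneous cubic $V\in\mathbb{C}[q_1,q_2,q_3]$, with $V'=\operatorname{grad}V$ and Hessian $V''$: a point $[d]\in\mathbb{CP}^2$ is a Darboux point of $V$ if $d\neq 0$ and $d\wedge V'(d)=0$; it is proper if $V'(d)\neq0$. For a proper Darboux point the representative $d$ is always chosen so that $V'(d)=d$. Then $d$ is an eigenvector of $V''(d)$ with (trivial) eigenvalue $2$; if $\lambda_1,\lambda_2,2$ are the eigenvalues of $V''(d)$ counted with multiplicity, the spectrum of $[d]$ is the unordered pair $(\Lambda_1,\Lambda_2)=(\lambda_1-1,\lambda_2-1)$. A Darboux point is simple if it is an isolated point of multiplicity one of the projective algebraic set defined by the polynomials $q_i\partial V/\partial q_j-q_j\partial V/\partial q_i$; for a proper Darboux point this is equivalent to $\Lambda_1\Lambda_2\neq0$. *)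

theory Defs
  imports "HOL-Analysis.Analysis" "HOL-Computational_Algebra.Computational_Algebra"
begin

text \<open>
  Polynomials in \<open>\<complex>[q\<^sub>1,q\<^sub>2,q\<^sub>3]\<close> are identified with the functions on \<open>\<complex>\<^sup>3\<close> they induce, and
  points of \<open>\<complex>P\<^sup>2\<close> are given by nonzero vectors, two of which are compared by \<open>same_point\<close>.
\<close>

inductive_set polynomial_functions :: "(complex^3 \<Rightarrow> complex) set" where
  const: "(\<lambda>q. c) \<in> polynomial_functions"
| coord: "(\<lambda>q. q $ i) \<in> polynomial_functions"
| add: "f \<in> polynomial_functions \<Longrightarrow> g \<in> polynomial_functions \<Longrightarrow> (\<lambda>q. f q + g q) \<in> polynomial_functions"
| mult: "f \<in> polynomial_functions \<Longrightarrow> g \<in> polynomial_functions \<Longrightarrow> (\<lambda>q. f q * g q) \<in> polynomial_functions"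

definition homogeneous_polynomial :: "nat \<Rightarrow> (complex^3 \<Rightarrow> complex) \<Rightarrow> bool" where
  "homogeneous_polynomial k f \<longleftrightarrow>
     f \<in> polynomial_functions \<and> (\<forall>c q. f (c *s q) = c ^ k * f q)"

definition same_point :: "complex^3 \<Rightarrow> complex^3 \<Rightarrow> bool" where
  "same_point d e \<longleftrightarrow> (\<exists>c. c \<noteq> 0 \<and> e = c *s d)"


definition partial_deriv :: "3 \<Rightarrow> (complex^3 \<Rightarrow> complex) \<Rightarrow> complex^3 \<Rightarrow> complex" where
  "partial_deriv i f q = deriv (\<lambda>t. f (q + t *s axis i 1)) 0"

definition grad :: "(complex^3 \<Rightarrow> complex) \<Rightarrow> complex^3 \<Rightarrow> complex^3" where
  "grad V q = (\<chi> i. partial_deriv i V q)"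

definition hessian :: "(complex^3 \<Rightarrow> complex) \<Rightarrow> complex^3 \<Rightarrow> complex^3^3" where
  "hessian V q = (\<chi> i j. partial_deriv i (partial_deriv j V) q)"

definition charpoly :: "complex^3^3 \<Rightarrow> complex poly" where
  "charpoly A = det (\<chi> i j. (if i = j then [:0, 1:] else 0) - [:A $ i $ j:])"

definition eigenvalues :: "complex^3^3 \<Rightarrow> complex multiset" where
  "eigenvalues A = proots (charpoly A)"


definition darboux_minor :: "(complex^3 \<Rightarrow> complex) \<Rightarrow> 3 \<Rightarrow> 3 \<Rightarrow> complex^3 \<Rightarrow> complex" where
  "darboux_minor V i j q = q $ i * partial_deriv j V q - q $ j * partial_deriv i V q"

definition darboux_minors :: "(complex^3 \<Rightarrow> complex) \<Rightarrow> (complex^3 \<Rightarrow> complex) set" where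
  "darboux_minors V = {darboux_minor V i j | i j. True}"

text \<open>The components of \<open>d \<and> V'(d)\<close> are the values of the minors at \<open>d\<close>.\<close>

definition darboux_point :: "(complex^3 \<Rightarrow> complex) \<Rightarrow> complex^3 \<Rightarrow> bool" where
  "darboux_point V d \<longleftrightarrow> d \<noteq> 0 \<and> (\<forall>i j. darboux_minor V i j d = 0)"

definition proper_darboux_point :: "(complex^3 \<Rightarrow> complex) \<Rightarrow> complex^3 \<Rightarrow> bool" where
  "proper_darboux_point V d \<longleftrightarrow> darboux_point V d \<and> grad V d \<noteq> 0"

text \<open>
  \<open>d\<close> has to be the representative normalised by \<open>V'(d) = d\<close>. The predicate is symmetric in the
  last two arguments, which form an unordered pair.
\<close>

definition has_spectrum ::
    "(complex^3 \<Rightarrow> complex) \<Rightarrow> complex^3 \<Rightarrow> complex \<Rightarrow> complex \<Rightarrow> bool" where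
  "has_spectrum V d \<Lambda>\<^sub>1 \<Lambda>\<^sub>2 \<longleftrightarrow> eigenvalues (hessian V d) = {#\<Lambda>\<^sub>1 + 1, \<Lambda>\<^sub>2 + 1, 2#}"


text \<open>
  For a finite set \<open>S\<close> of homogeneous polynomials, the multiplicity of a point \<open>[d]\<close> of the
  projective algebraic set defined by \<open>S\<close> is the dimension of the complex vector space
  \<open>\<O> / \<I>\<close>, where \<open>\<O>\<close> is the local ring of \<open>\<complex>P\<^sup>2\<close> at \<open>[d]\<close> (fractions \<open>F/G\<close> of homogeneous
  polynomials of equal degree with \<open>G(d) \<noteq> 0\<close>) and \<open>\<I>\<close> is the ideal of fractions whose numerator
  lies in the ideal generated by \<open>S\<close>. An element of \<open>\<O>\<close> is represented by any function with the
  same germ at \<open>d\<close>; functions with zero germ belong to \<open>\<I>\<close>, so \<open>\<O> / \<I>\<close> is not affected.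
\<close>

definition generated_ideal :: "(complex^3 \<Rightarrow> complex) set \<Rightarrow> (complex^3 \<Rightarrow> complex) set" where
  "generated_ideal S =
     {\<lambda>q. \<Sum>f\<in>S. h f q * f q | h. \<forall>f\<in>S. h f \<in> polynomial_functions}"

definition local_ring :: "complex^3 \<Rightarrow> (complex^3 \<Rightarrow> complex) set" where
  "local_ring d =
     {r. \<exists>k F G. homogeneous_polynomial k F \<and> homogeneous_polynomial k G \<and> G d \<noteq> 0 \<and>
           (\<forall>\<^sub>F q in nhds d. r q = F q / G q)}"

definition local_ideal :: "(complex^3 \<Rightarrow> complex) set \<Rightarrow> complex^3 \<Rightarrow> (complex^3 \<Rightarrow> complex) set" where
  "local_ideal S d =
     {r. \<exists>k F G. homogeneous_polynomial k F \<and> F \<in> generated_ideal S \<and>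
           homogeneous_polynomial k G \<and> G d \<noteq> 0 \<and>
           (\<forall>\<^sub>F q in nhds d. r q = F q / G q)}"

text \<open>The family \<open>b 0, \<dots>, b (n - 1)\<close> below is a basis of \<open>\<O> / \<I>\<close>.\<close>

definition has_multiplicity :: "(complex^3 \<Rightarrow> complex) set \<Rightarrow> complex^3 \<Rightarrow> nat \<Rightarrow> bool" where
  "has_multiplicity S d n \<longleftrightarrow>
     (\<exists>b :: nat \<Rightarrow> complex^3 \<Rightarrow> complex.
        (\<forall>m<n. b m \<in> local_ring d) \<and>
        (\<forall>r\<in>local_ring d. \<exists>!c :: nat \<Rightarrow> complex. (\<forall>m\<ge>n. c m = 0) \<and>
           (\<lambda>q. r q - (\<Sum>m<n. c m * b m q)) \<in> local_ideal S d))"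

text \<open>The topology of \<open>\<complex>P\<^sup>2\<close> is the quotient topology of \<open>\<complex>\<^sup>3 - {0}\<close>, and the projection is open.\<close>

definition isolated_zero :: "(complex^3 \<Rightarrow> complex) set \<Rightarrow> complex^3 \<Rightarrow> bool" where
  "isolated_zero S d \<longleftrightarrow>
     d \<noteq> 0 \<and> (\<forall>f\<in>S. f d = 0) \<and>
     (\<forall>\<^sub>F q in nhds d. (\<forall>f\<in>S. f q = 0) \<longrightarrow> same_point d q)"

definition simple_darboux_point :: "(complex^3 \<Rightarrow> complex) \<Rightarrow> complex^3 \<Rightarrow> bool" where
  "simple_darboux_point V d \<longleftrightarrow>
     darboux_point V d \<and> isolated_zero (darboux_minors V) d \<and>
     has_multiplicity (darboux_minors V) d 1"

end

theory Submission
  imports Defs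
begin

text \<open>
  In the isotropic coordinates \<open>z = q\<^sub>1 + \<i>q\<^sub>2\<close>, \<open>w = q\<^sub>1 - \<i>q\<^sub>2\<close> the potential is
  \<open>b\<^sub>0z\<^sup>3 + b\<^sub>1z\<^sup>2w + b\<^sub>2zw\<^sup>2 + b\<^sub>3w\<^sup>3 + z\<^sup>2q\<^sub>3\<close>, and \<open>V'(d) = d\<close> reads \<open>z = 2V\<^sub>w\<close>, \<open>w = 2V\<^sub>z\<close>,
  \<open>q\<^sub>3 = z\<^sup>2\<close>. For \<open>z \<noteq> 0\<close> the slope \<open>s = w/z\<close> determines \<open>d\<close> because \<open>2zP(s) = 1\<close> with
  \<open>P = b\<^sub>1 + 2b\<^sub>2s + 3b\<^sub>3s\<^sup>2\<close>, and it is a root of the quintic \<open>F = P(sP - Q) - 1\<close> with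
  \<open>Q = 3b\<^sub>0 + 2b\<^sub>1s + b\<^sub>2s\<^sup>2\<close>. If \<open>b\<^sub>3 = 0\<close> then \<open>F\<close> has at most three roots and there is at most one
  solution with \<open>z = 0\<close>, so five Darboux points force \<open>b\<^sub>3 \<noteq> 0\<close> and are given by the five roots
  of \<open>F\<close>. The trace of \<open>V''(d)\<close> and the determinant of \<open>1 - V''(d)\<close> turn out to say
  \<open>\<Lambda>\<^sub>1\<Lambda>\<^sub>2 = F'(s)/P(s)\<^sup>2\<close> and \<open>\<Lambda>\<^sub>1 + \<Lambda>\<^sub>2 = 4(R(s) - P(s))/P(s)\<close> with \<open>R = b\<^sub>1 + b\<^sub>2s\<close>. Hence each sum
  has the form \<open>\<Sum>\<^sub>s g(s)/F'(s)\<close> with \<open>deg g \<le> 4\<close>, which by Lagrange interpolation equals the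
  \<open>s\<^sup>4\<close>-coefficient of \<open>g\<close> divided by the leading coefficient \<open>9b\<^sub>3\<^sup>2\<close> of \<open>F\<close>.
\<close>

no_notation fps_nth (infixl \<open>$\<close> 75)

section \<open>Eigenvalues of 3 by 3 matrices, and an interpolation identity\<close>

lemma poly_charpoly: "poly (charpoly A) t = det (mat t - A)"
  by (simp add: charpoly_def det_3 mat_def algebra_simps)

lemma charpoly_3:
  "charpoly A = [:- det A,
     A$1$1 * A$2$2 + A$1$1 * A$3$3 + A$2$2 * A$3$3
       - A$1$2 * A$2$1 - A$1$3 * A$3$1 - A$2$3 * A$3$2, - trace A, 1:]"
  by (simp add: charpoly_def det_3 trace_def sum_3 algebra_simps)

lemma lead_coeff_charpoly: "lead_coeff (charpoly A) = 1"
  by (simp add: charpoly_3)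

text \<open>The characteristic polynomial is monic and splits over the complex numbers.\<close>

lemma charpoly_eq_prod_eigenvalues:
  assumes "eigenvalues A = {#x, y, v#}"
  shows "charpoly A = [:-x, 1:] * ([:-y, 1:] * [:-v, 1:])"
proof -
  have "charpoly A = smult (lead_coeff (charpoly A)) (\<Prod>x\<in>#eigenvalues A. [:-x, 1:])"
    by (simp only: eigenvalues_def complex_poly_decompose_multiset)
  then show ?thesis
    by (simp only: lead_coeff_charpoly assms image_mset_add_mset prod_mset.add_mset
        image_mset_empty prod_mset_empty mult_1_right smult_1_left)
qed

lemma trace_eq_sum_eigenvalues:
  assumes "eigenvalues A = {#x, y, v#}"
  shows "trace A = x + y + v"
proof -
  have "poly.coeff (charpoly A) 2 = - trace A"
    by (simp add: charpoly_3 numeral_2_eq_2)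
  moreover have "poly.coeff (charpoly A) 2 = - (x + y + v)"
    by (simp add: charpoly_eq_prod_eigenvalues[OF assms] numeral_2_eq_2)
  ultimately show ?thesis
    by (simp only: neg_equal_iff_equal)
qed

lemma det_mat_minus_eq_prod_eigenvalues:
  assumes "eigenvalues A = {#x, y, v#}"
  shows "det (mat t - A) = (t - x) * (t - y) * (t - v)"
  by (simp add: charpoly_eq_prod_eigenvalues[OF assms] algebra_simps flip: poly_charpoly)

text \<open>Having \<open>degree F\<close> distinct roots makes \<open>F\<close> split into distinct
  linear factors, so up to the leading coefficient \<open>poly (pderiv F) a\<close> is the
  denominator of the Lagrange basis polynomial at \<open>a\<close>. The identity compares top
  coefficients of \<open>g\<close> and its interpolant \<open>h\<close>.\<close>

lemma sum_div_pderiv_roots: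
  fixes F g :: "'a :: field poly"
  assumes fin: "finite S" and card: "card S = degree F" and "F \<noteq> 0" and ne: "S \<noteq> {}"
    and roots: "\<And>a. a \<in> S \<Longrightarrow> poly F a = 0" and deg: "degree g < card S"
  shows "(\<Sum>a\<in>S. poly g a / poly (pderiv F) a) = poly.coeff g (card S - 1) / lead_coeff F"
proof -
  define L where "L a = (\<Prod>b\<in>S - {a}. [:-b, 1:])" for a
  define c where "c = lead_coeff F"
  have c: "c \<noteq> 0" using \<open>F \<noteq> 0\<close> by (simp add: c_def)
  have degL: "degree (L a) = card S - 1" if "a \<in> S" for a
    using that fin by (simp add: L_def degree_prod_sum_eq)
  have coeffL: "poly.coeff (L a) (card S - 1) = 1" if "a \<in> S" for a
    unfolding degL[OF that, symmetric] unfolding L_def lead_coeff_prod by simp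
  have Lab: "poly (L a) b = 0" if "a \<in> S" "b \<in> S" "a \<noteq> b" for a b
    using that fin by (auto simp: L_def poly_prod)
  have Laa: "poly (L a) a \<noteq> 0" for a
    using fin by (auto simp: L_def poly_prod)
  have F: "F = smult c (\<Prod>a\<in>S. [:-a, 1:])"
  proof (rule poly_eqI_degree_lead_coeff[where A = S and n = "card S"])
    show "poly.coeff F (card S) = poly.coeff (smult c (\<Prod>a\<in>S. [:-a, 1:])) (card S)"
      using lead_coeff_prod[of "\<lambda>a. [:-a, 1:]" S]
      by (simp add: card c_def degree_prod_sum_eq)
  qed (use fin card roots c in \<open>auto simp: degree_prod_sum_eq poly_prod\<close>)
  have dF: "poly (pderiv F) a = c * poly (L a) a" if "a \<in> S" for a
  proof -
    have "poly (pderiv F) a = c * (\<Sum>b\<in>S. poly (L b) a)"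
      by (simp add: F pderiv_smult pderiv_prod pderiv_pCons poly_sum L_def)
    also have "(\<Sum>b\<in>S. poly (L b) a) = poly (L a) a"
      using that fin Lab by (subst sum.remove[of S a]) auto
    finally show ?thesis .
  qed
  define h where "h = (\<Sum>a\<in>S. smult (poly g a / poly (L a) a) (L a))"
  have "g = h"
  proof (rule poly_eqI_degree[where A = S])
    fix a assume a: "a \<in> S"
    have "poly h a = (\<Sum>b\<in>S. if b = a then poly g a else 0)"
      unfolding h_def poly_sum using a Lab Laa by (intro sum.cong) auto
    then show "poly g a = poly h a" using fin a by simp
  next
    have "degree h \<le> card S - 1"
      unfolding h_def by (intro degree_sum_le fin) (auto intro!: order.trans[OF degree_smult_le] simp: degL)
    then show "degree h < card S" using ne fin card_gt_0_iff[of S] by linarith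
  qed (use deg in auto)
  have "poly.coeff h (card S - 1) = (\<Sum>a\<in>S. poly g a / poly (L a) a)"
    by (simp add: h_def coeff_sum coeffL[simplified])
  then show ?thesis
    using c \<open>g = h\<close> by (simp add: dF sum_divide_distrib mult.commute flip: c_def)
qed

section \<open>Derivatives of the potential in isotropic coordinates\<close>

definition zc :: "complex^3 \<Rightarrow> complex" where "zc q = q$1 + \<i> * q$2"
definition wc :: "complex^3 \<Rightarrow> complex" where "wc q = q$1 - \<i> * q$2"

context
  fixes b0 b1 b2 b3 :: complex
begin

definition cubic :: "complex^3 \<Rightarrow> complex" where
  "cubic q = b0 * zc q ^ 3 + b1 * zc q ^ 2 * wc q + b2 * zc q * wc q ^ 2 + b3 * wc q ^ 3 + zc q ^ 2 * q$3"

definition cubic_z :: "complex^3 \<Rightarrow> complex" where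
  "cubic_z q = 3 * b0 * zc q ^ 2 + 2 * b1 * zc q * wc q + b2 * wc q ^ 2 + 2 * zc q * q$3"

definition cubic_w :: "complex^3 \<Rightarrow> complex" where
  "cubic_w q = b1 * zc q ^ 2 + 2 * b2 * zc q * wc q + 3 * b3 * wc q ^ 2"

text \<open>Chain rule: \<open>zc\<close> and \<open>wc\<close> both have derivative 1 along the
  first axis, and \<open>\<i>\<close> and \<open>- \<i>\<close> along the second.\<close>

lemma partial_deriv_cubic:
  "partial_deriv 1 cubic = (\<lambda>q. cubic_z q + cubic_w q)"
  "partial_deriv 2 cubic = (\<lambda>q. \<i> * (cubic_z q - cubic_w q))"
  "partial_deriv 3 cubic = (\<lambda>q. zc q ^ 2)"
  unfolding partial_deriv_def cubic_def cubic_z_def cubic_w_def zc_def wc_def fun_eq_iff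
  by (auto simp: axis_def intro!: DERIV_imp_deriv derivative_eq_intros; simp add: algebra_simps power2_eq_square)+

lemma partial_deriv_zc_square:
  "partial_deriv 1 (\<lambda>q. zc q ^ 2) q = 2 * zc q"
  "partial_deriv 2 (\<lambda>q. zc q ^ 2) q = \<i> * (2 * zc q)"
  "partial_deriv 3 (\<lambda>q. zc q ^ 2) q = 0"
  unfolding partial_deriv_def zc_def
  by (auto simp: axis_def intro!: DERIV_imp_deriv derivative_eq_intros; simp add: algebra_simps power2_eq_square)+

text \<open>The first two partial derivatives of \<open>cubic\<close> are the cases
  \<open>c = e = 1\<close> and \<open>c = \<i>\<close>, \<open>e = - \<i>\<close>, so one
  computation serves two columns of the Hessian.\<close>

lemma partial_deriv_gradient_comb:
  fixes c e :: complex
  defines "czz q \<equiv> 6 * b0 * zc q + 2 * b1 * wc q + 2 * q$3"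
    and "czw q \<equiv> 2 * b1 * zc q + 2 * b2 * wc q"
    and "cww q \<equiv> 2 * b2 * zc q + 6 * b3 * wc q"
  shows "partial_deriv 1 (\<lambda>q. c * cubic_z q + e * cubic_w q) q = c * (czz q + czw q) + e * (czw q + cww q)"
  "partial_deriv 2 (\<lambda>q. c * cubic_z q + e * cubic_w q) q = \<i> * (c * (czz q - czw q) + e * (czw q - cww q))"
  "partial_deriv 3 (\<lambda>q. c * cubic_z q + e * cubic_w q) q = c * (2 * zc q)"
  unfolding partial_deriv_def cubic_z_def cubic_w_def zc_def wc_def assms
  by (auto simp: axis_def intro!: DERIV_imp_deriv derivative_eq_intros; simp add: algebra_simps power2_eq_square)+

lemma hessian_cubic:
  fixes q :: "complex^3"
  defines "czz \<equiv> 6 * b0 * zc q + 2 * b1 * wc q + 2 * q$3"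
    and "czw \<equiv> 2 * b1 * zc q + 2 * b2 * wc q"
    and "cww \<equiv> 2 * b2 * zc q + 6 * b3 * wc q"
  shows "hessian cubic q $ 1 $ 1 = czz + 2 * czw + cww"
    and "hessian cubic q $ 1 $ 2 = \<i> * (czz - cww)"
    and "hessian cubic q $ 1 $ 3 = 2 * zc q"
    and "hessian cubic q $ 2 $ 1 = \<i> * (czz - cww)"
    and "hessian cubic q $ 2 $ 2 = - (czz - 2 * czw + cww)"
    and "hessian cubic q $ 2 $ 3 = \<i> * (2 * zc q)"
    and "hessian cubic q $ 3 $ 1 = 2 * zc q"
    and "hessian cubic q $ 3 $ 2 = \<i> * (2 * zc q)"
    and "hessian cubic q $ 3 $ 3 = 0"
  using partial_deriv_gradient_comb[of 1 1 q] partial_deriv_gradient_comb[of "\<i>" "- \<i>" q]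
  by (simp_all add: hessian_def partial_deriv_cubic partial_deriv_zc_square assms right_diff_distrib)
     (simp_all add: algebra_simps)

lemma trace_hessian_cubic:
  "trace (hessian cubic q) = 8 * (b1 * zc q + b2 * wc q)"
  by (simp add: trace_def sum_3 hessian_cubic)

text \<open>With eigenvalues \<open>L1 + 1\<close>, \<open>L2 + 1\<close> and 2 this determinant
  equals \<open>- (L1 * L2)\<close>.\<close>

lemma det_1_minus_hessian_cubic:
  "det (mat 1 - hessian cubic q) =
     (1 - 4 * (b1 * zc q + b2 * wc q))^2
     - 4 * (2 * b2 * zc q + 6 * b3 * wc q) * (6 * b0 * zc q + 2 * b1 * wc q + 2 * q$3 + 4 * zc q ^ 2)"
  unfolding det_3 vector_minus_component hessian_cubic
  by (simp add: mat_def algebra_simps power2_eq_square)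

section \<open>Normalised Darboux points, their slopes and spectra\<close>

lemma grad_cubic_fixed:
  assumes "grad cubic q = q"
  shows "zc q = 2 * cubic_w q" "wc q = 2 * cubic_z q" "q$3 = zc q ^ 2"
proof -
  have e: "q$1 = cubic_z q + cubic_w q" "q$2 = \<i> * (cubic_z q - cubic_w q)"
    using assms[THEN arg_cong, of "\<lambda>v. v$1"] assms[THEN arg_cong, of "\<lambda>v. v$2"]
    by (simp_all add: grad_def partial_deriv_cubic)
  show "q$3 = zc q ^ 2"
    using assms[THEN arg_cong, of "\<lambda>v. v$3"] by (simp add: grad_def partial_deriv_cubic)
  show "zc q = 2 * cubic_w q" unfolding zc_def[of q] e by (simp add: algebra_simps)
  show "wc q = 2 * cubic_z q" unfolding wc_def[of q] e by (simp add: algebra_simps)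
qed


lemma vec3_eqI:
  assumes "zc p = zc q" "wc p = wc q" "p$3 = q$3"
  shows "p = q"
proof -
  have "2 * p$1 = 2 * q$1" "2 * \<i> * p$2 = 2 * \<i> * q$2"
    using assms(1,2) unfolding zc_def wc_def by algebra+
  then show ?thesis
    using assms(3) by (simp add: vec_eq_iff forall_3)
qed

text \<open>\<open>G_poly\<close> is the combination \<open>sP - Q\<close> of the argument above.\<close>

definition P_poly :: "complex poly" where "P_poly = [:b1, 2 * b2, 3 * b3:]"
definition G_poly :: "complex poly" where "G_poly = [:- 3 * b0, - b1, b2, 3 * b3:]"
definition R_poly :: "complex poly" where "R_poly = [:b1, b2:]"
definition F_poly :: "complex poly" where "F_poly = P_poly * G_poly - 1"

text \<open>The equations reduce to \<open>0 = 6 * b3 * wc q ^ 2\<close> and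
  \<open>wc q = 2 * b2 * wc q ^ 2\<close>, and \<open>wc q\<close> cannot vanish since
  \<open>q\<close> is nonzero.\<close>

lemma fixed_zc_0:
  assumes "grad cubic q = q" "zc q = 0" "q \<noteq> 0"
  shows "b3 = 0" "wc q = 1 / (2 * b2)" "q$3 = 0"
proof -
  note g = grad_cubic_fixed[OF assms(1), unfolded cubic_z_def cubic_w_def assms(2)]
  show q3: "q$3 = 0" using g by simp
  have "wc q \<noteq> 0" using assms q3 vec3_eqI[of q 0] by (auto simp: zc_def wc_def)
  then show "b3 = 0" "wc q = 1 / (2 * b2)" using g by (auto simp: power2_eq_square eq_divide_eq ac_simps)
qed

lemma fixed_zc_nonzero:
  assumes "grad cubic q = q" "zc q \<noteq> 0"
  defines "s \<equiv> wc q / zc q"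
  shows "2 * zc q * poly P_poly s = 1" "poly F_poly s = 0"
proof -
  note g = grad_cubic_fixed[OF assms(1), unfolded cubic_z_def cubic_w_def]
  have w: "wc q = s * zc q" using assms by simp
  have "zc q * (2 * zc q * poly P_poly s) = zc q * 1"
    using g(1) unfolding P_poly_def w by (simp add: algebra_simps power2_eq_square)
  then show p: "2 * zc q * poly P_poly s = 1" using assms(2) by (metis mult_left_cancel)
  have "zc q * s = zc q * (2 * zc q * (3 * b0 + 2 * b1 * s + b2 * s^2) + 4 * zc q ^ 2)"
    using g(2) unfolding g(3) w by (simp add: algebra_simps power2_eq_square)
  then have "s = 2 * zc q * (3 * b0 + 2 * b1 * s + b2 * s^2) + 4 * zc q ^ 2"
    using assms(2) by (metis mult_left_cancel)
  moreover have "poly G_poly s = s * poly P_poly s - (3 * b0 + 2 * b1 * s + b2 * s^2)"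
    by (simp add: P_poly_def G_poly_def algebra_simps power2_eq_square)
  \<comment> \<open>Multiplying by \<open>poly P_poly s ^ 2\<close> and using
    \<open>2 * zc q * poly P_poly s = 1\<close> eliminates \<open>zc q\<close>.\<close>
  ultimately have "poly P_poly s * poly G_poly s = 1"
    using p by algebra
  then show "poly F_poly s = 0" by (simp add: F_poly_def)
qed

lemma spectrum_at_fixed:
  assumes "grad cubic q = q" "zc q \<noteq> 0" "has_spectrum cubic q L1 L2"
  defines "s \<equiv> wc q / zc q"
  shows "L1 * L2 = poly (pderiv F_poly) s / poly P_poly s ^ 2"
    and "L1 + L2 = 4 * poly (R_poly - P_poly) s / poly P_poly s"
proof -
  note p = fixed_zc_nonzero[OF assms(1,2), folded s_def]
  have w: "wc q = s * zc q" using assms by simp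
  have p0: "poly P_poly s \<noteq> 0" using p(1) by auto
  note ev = assms(3)[unfolded has_spectrum_def]
  have "L1 + L2 = 8 * zc q * poly R_poly s - 4"
    using trace_eq_sum_eigenvalues[OF ev] unfolding trace_hessian_cubic w
    by (simp add: R_poly_def algebra_simps)
  also have "8 * zc q * poly R_poly s = 4 * poly R_poly s / poly P_poly s"
    using p(1) p0 by (simp add: field_simps)
  finally show "L1 + L2 = 4 * poly (R_poly - P_poly) s / poly P_poly s"
    using p0 by (simp add: field_simps)
  have q3: "q$3 = zc q ^ 2" by (rule grad_cubic_fixed(3)[OF assms(1)])
  have "L1 * L2 = - det (mat 1 - hessian cubic q)"
    by (simp add: det_mat_minus_eq_prod_eigenvalues[OF ev])
  then have L: "L1 * L2 = 4 * (2 * b2 * zc q + 6 * b3 * wc q) * (6 * b0 * zc q + 2 * b1 * wc q + 6 * zc q ^ 2)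
       - (1 - 4 * (b1 * zc q + b2 * wc q))^2"
    unfolding det_1_minus_hessian_cubic q3 by simp
  have F_poly: "poly P_poly s * poly G_poly s = 1" using p(2) by (simp add: F_poly_def)
  have "poly (pderiv F_poly) s = (2 * b2 + 6 * b3 * s) * poly G_poly s + poly P_poly s * (- b1 + 2 * b2 * s + 9 * b3 * s^2)"
    by (simp add: F_poly_def pderiv_mult pderiv_diff P_poly_def G_poly_def pderiv_pCons algebra_simps power2_eq_square)
  \<comment> \<open>The derivative is regrouped to match the two terms of \<open>L\<close>.\<close>
  also have "\<dots> = (2 * b2 + 6 * b3 * s) * (6 * b0 + 2 * b1 * s + 3 * poly G_poly s) - (poly P_poly s - 2 * poly R_poly s)^2"
    by (simp add: P_poly_def G_poly_def R_poly_def algebra_simps power2_eq_square)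
  also have "poly G_poly s = 2 * zc q"
    using p(1) F_poly by algebra
  \<comment> \<open>Inserting factors \<open>2 * zc q * poly P_poly s\<close>, which equal 1, lets
    \<open>poly P_poly s ^ 2\<close> be pulled out.\<close>
  also have "(2 * b2 + 6 * b3 * s) * (6 * b0 + 2 * b1 * s + 3 * (2 * zc q)) - (poly P_poly s - 2 * poly R_poly s)^2 =
      (2 * zc q * poly P_poly s)^2 * ((2 * b2 + 6 * b3 * s) * (6 * b0 + 2 * b1 * s + 3 * (2 * zc q)))
      - (poly P_poly s - 2 * (2 * zc q * poly P_poly s) * poly R_poly s)^2"
    unfolding p(1) by simp
  also have "\<dots> = L1 * L2 * poly P_poly s ^ 2"
    unfolding L w R_poly_def by (simp add: algebra_simps power2_eq_square)
  finally have "poly (pderiv F_poly) s = L1 * L2 * poly P_poly s ^ 2" .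
  then show "L1 * L2 = poly (pderiv F_poly) s / poly P_poly s ^ 2"
    using p0 by simp
qed

section \<open>Degree and number of roots of the quintic\<close>

lemma F_poly_eq:
  "F_poly = [:- 3 * b0 * b1 - 1, - (b1^2) - 6 * b0 * b2, - b1 * b2 - 9 * b0 * b3,
         2 * b2^2, 9 * b2 * b3, 9 * b3^2:]"
  by (simp add: F_poly_def P_poly_def G_poly_def power2_eq_square one_pCons algebra_simps)

lemma degree_F_poly: "b3 \<noteq> 0 \<Longrightarrow> degree F_poly = 5" and lead_coeff_F_poly: "b3 \<noteq> 0 \<Longrightarrow> lead_coeff F_poly = 9 * b3^2"
  by (simp_all add: F_poly_eq)

text \<open>If all coefficients vanished, then \<open>b3\<close>, \<open>b2\<close> and
  \<open>b1\<close> would be 0 in turn, leaving the constant term -1.\<close>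

lemma F_poly_nonzero: "F_poly \<noteq> 0"
  unfolding F_poly_eq by auto

lemma card_roots_F_poly:
  assumes "b3 = 0"
  shows "card {s. poly F_poly s = 0} \<le> 3"
proof -
  have "degree F_poly \<le> 3" unfolding F_poly_eq using assms by simp
  then show ?thesis using card_poly_roots_bound[OF F_poly_nonzero] by linarith
qed

lemma fixed_eqI:
  assumes "grad cubic p = p" "grad cubic q = q" "zc p \<noteq> 0" "zc q \<noteq> 0"
    and "wc p / zc p = wc q / zc q"
  shows "p = q"
proof (rule vec3_eqI)
  show z: "zc p = zc q"
    using fixed_zc_nonzero(1)[OF assms(1,3)] fixed_zc_nonzero(1)[OF assms(2,4)]
    unfolding assms(5) by algebra
  show "wc p = wc q" using assms(3-5) z by (simp add: field_simps)
  show "p $ 3 = q $ 3" using grad_cubic_fixed(3)[OF assms(1)] grad_cubic_fixed(3)[OF assms(2)] z by simp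
qed

section \<open>Five Darboux points and the three sums\<close>

context
  fixes d :: "'i \<Rightarrow> complex^3" and I :: "'i set"
  assumes card_I: "card I = 5" and inj_d: "inj_on d I"
    and nonzero: "\<And>i. i \<in> I \<Longrightarrow> d i \<noteq> 0"
    and fixed: "\<And>i. i \<in> I \<Longrightarrow> grad cubic (d i) = d i"
begin

lemma finite_I: "finite I"
  using card_I card.infinite by fastforce

definition slope :: "'i \<Rightarrow> complex" where "slope i = wc (d i) / zc (d i)"

lemma inj_slope: "inj_on slope {i \<in> I. zc (d i) \<noteq> 0}"
  using fixed_eqI[OF fixed fixed] inj_d by (auto simp: slope_def inj_on_def)

lemma b3_nonzero: "b3 \<noteq> 0"
proof
  assume "b3 = 0"
  define J where "J = {i \<in> I. zc (d i) = 0}"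
  define K where "K = {i \<in> I. zc (d i) \<noteq> 0}"
  have "i = j" if "i \<in> J" "j \<in> J" for i j
  proof -
    have "d i = d j"
      using that fixed_zc_0[OF fixed _ nonzero, of i] fixed_zc_0[OF fixed _ nonzero, of j]
      by (intro vec3_eqI) (simp_all add: J_def)
    then show ?thesis using inj_d that by (auto simp: J_def inj_on_def)
  qed
  then have "card J \<le> 1" using finite_I by (auto simp: J_def card_le_Suc0_iff_eq)
  moreover have "card K \<le> 3"
  proof -
    have "card (slope ` K) \<le> card {s. poly F_poly s = 0}"
      using fixed_zc_nonzero(2)[OF fixed] F_poly_nonzero by (intro card_mono poly_roots_finite) (auto simp: K_def slope_def)
    then show ?thesis
      using card_roots_F_poly[OF \<open>b3 = 0\<close>] card_image[OF inj_slope] unfolding K_def by linarith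
  qed
  moreover have "J \<union> K = I" by (auto simp: J_def K_def)
  ultimately show False using card_Un_le[of J K] card_I by simp
qed

lemma zc_nonzero: "i \<in> I \<Longrightarrow> zc (d i) \<noteq> 0"
  using fixed_zc_0(1)[OF fixed _ nonzero, of i] b3_nonzero by auto

text \<open>The five distinct slopes are all the roots of the quintic, so the interpolation identity
  applies.\<close>

lemma sum_slope:
  assumes "degree g \<le> 4"
  shows "(\<Sum>i\<in>I. poly g (slope i) / poly (pderiv F_poly) (slope i)) = poly.coeff g 4 / (9 * b3^2)"
proof -
  have inj: "inj_on slope I"
    using inj_slope zc_nonzero by (simp add: inj_on_def)
  have card: "card (slope ` I) = 5" by (simp add: card_image inj card_I)
  have "(\<Sum>a\<in>slope ` I. poly g a / poly (pderiv F_poly) a) = poly.coeff g (card (slope ` I) - 1) / lead_coeff F_poly"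
  proof (rule sum_div_pderiv_roots)
    show "card (slope ` I) = degree F_poly" by (simp add: card degree_F_poly b3_nonzero)
    show "F_poly \<noteq> 0" by (rule F_poly_nonzero)
    show "slope ` I \<noteq> {}" using card by auto
    show "poly F_poly a = 0" if "a \<in> slope ` I" for a
      using that fixed_zc_nonzero(2)[OF fixed zc_nonzero] by (auto simp: slope_def)
  qed (use finite_I assms card in auto)
  then show ?thesis
    by (simp add: sum.reindex[OF inj] card_image inj card_I lead_coeff_F_poly b3_nonzero)
qed

lemma spectrum_sums:
  assumes "\<And>i. i \<in> I \<Longrightarrow> has_spectrum cubic (d i) (L1 i) (L2 i)"
  shows "(\<Sum>i\<in>I. 1 / (L1 i * L2 i)) = 1"
    and "(\<Sum>i\<in>I. (L1 i + L2 i) / (L1 i * L2 i)) = -4"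
    and "(\<Sum>i\<in>I. (L1 i + L2 i)^2 / (L1 i * L2 i)) = 16"
proof -
  have p0: "poly P_poly (slope i) \<noteq> 0" if "i \<in> I" for i
    using fixed_zc_nonzero(1)[OF fixed zc_nonzero, OF that that] by (auto simp: slope_def)
  note L = spectrum_at_fixed[OF fixed zc_nonzero assms, folded slope_def]
  have "(\<Sum>i\<in>I. 1 / (L1 i * L2 i)) = (\<Sum>i\<in>I. poly (P_poly^2) (slope i) / poly (pderiv F_poly) (slope i))"
    by (intro sum.cong refl) (simp add: L)
  \<comment> \<open>The coefficient of degree 4 in \<open>P_poly^2\<close> is
    \<open>9 * b3^2\<close>.\<close>
  also have "\<dots> = 1"
    using b3_nonzero by (subst sum_slope) (simp_all add: P_poly_def power2_eq_square eval_nat_numeral)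
  finally show "(\<Sum>i\<in>I. 1 / (L1 i * L2 i)) = 1" .
  have "(\<Sum>i\<in>I. (L1 i + L2 i) / (L1 i * L2 i)) =
      (\<Sum>i\<in>I. poly (smult 4 ((R_poly - P_poly) * P_poly)) (slope i) / poly (pderiv F_poly) (slope i))"
    using p0 by (intro sum.cong refl) (simp add: L power2_eq_square)
  \<comment> \<open>Since \<open>R_poly\<close> has degree at most 1, \<open>R_poly - P_poly\<close>
    has leading coefficient \<open>- 3 * b3\<close>; the coefficient of degree 4 is
    \<open>- 36 * b3^2\<close>.\<close>
  also have "\<dots> = -4"
    using b3_nonzero by (subst sum_slope) (simp_all add: P_poly_def R_poly_def power2_eq_square eval_nat_numeral)
  finally show "(\<Sum>i\<in>I. (L1 i + L2 i) / (L1 i * L2 i)) = -4" .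
  have "(\<Sum>i\<in>I. (L1 i + L2 i)^2 / (L1 i * L2 i)) =
      (\<Sum>i\<in>I. poly (smult 16 ((R_poly - P_poly)^2)) (slope i) / poly (pderiv F_poly) (slope i))"
    using p0 by (intro sum.cong refl) (simp add: L power2_eq_square, simp add: algebra_simps)
  also have "\<dots> = 16"
    using b3_nonzero by (subst sum_slope) (simp_all add: P_poly_def R_poly_def power2_eq_square eval_nat_numeral)
  finally show "(\<Sum>i\<in>I. (L1 i + L2 i)^2 / (L1 i * L2 i)) = 16" .
qed

end

end

text \<open>The coefficients come from substituting \<open>(zc q + wc q) / 2\<close> for
  \<open>q$1\<close> and \<open>(zc q - wc q) / (2 * \<i>)\<close> for \<open>q$2\<close>.\<close>

lemma cubic_in_null_coordinates:
  fixes a1 a2 a4 a5 :: complex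
  shows "(\<lambda>q::complex^3. a1 * (q$1)^3 + a2 * (q$1)^2 * q$2 + a4 * q$1 * (q$2)^2 + a5 * (q$2)^3
            + (q$1 + \<i> * q$2)^2 * q$3)
    = cubic ((a1 - \<i> * a2 - a4 + \<i> * a5) / 8) ((3 * a1 - \<i> * a2 + a4 - 3 * \<i> * a5) / 8)
        ((3 * a1 + \<i> * a2 + a4 + 3 * \<i> * a5) / 8) ((a1 + \<i> * a2 - a4 - \<i> * a5) / 8)"
  by (simp add: fun_eq_iff cubic_def zc_def wc_def field_simps power2_eq_square power3_eq_cube)

theorem lemma4p3:
  fixes a\<^sub>1 a\<^sub>2 a\<^sub>4 a\<^sub>5 :: complex
    and V :: "complex^3 \<Rightarrow> complex"
    and d :: "nat \<Rightarrow> complex^3"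
    and \<Lambda>\<^sub>1 \<Lambda>\<^sub>2 :: "nat \<Rightarrow> complex"
  assumes "V = (\<lambda>q. a\<^sub>1 * (q$1)^3 + a\<^sub>2 * (q$1)^2 * q$2 + a\<^sub>4 * q$1 * (q$2)^2 + a\<^sub>5 * (q$2)^3
                      + (q$1 + \<i> * q$2)^2 * q$3)"
    and "\<And>i. i \<in> {1..5} \<Longrightarrow> proper_darboux_point V (d i)"
    and "\<And>i. i \<in> {1..5} \<Longrightarrow> simple_darboux_point V (d i)"
    and "\<And>i j. i \<in> {1..5} \<Longrightarrow> j \<in> {1..5} \<Longrightarrow> i \<noteq> j \<Longrightarrow> \<not> same_point (d i) (d j)"
    and "\<And>i. i \<in> {1..5} \<Longrightarrow> grad V (d i) = d i"
    and "\<And>i. i \<in> {1..5} \<Longrightarrow> has_spectrum V (d i) (\<Lambda>\<^sub>1 i) (\<Lambda>\<^sub>2 i)"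
  shows "(\<Sum>i=1..5. 1 / (\<Lambda>\<^sub>1 i * \<Lambda>\<^sub>2 i)) = 1
         \<and> (\<Sum>i=1..5. (\<Lambda>\<^sub>1 i + \<Lambda>\<^sub>2 i) / (\<Lambda>\<^sub>1 i * \<Lambda>\<^sub>2 i)) = -4
         \<and> (\<Sum>i=1..5. (\<Lambda>\<^sub>1 i + \<Lambda>\<^sub>2 i)^2 / (\<Lambda>\<^sub>1 i * \<Lambda>\<^sub>2 i)) = 16"
proof -
  obtain b0 b1 b2 b3 where V: "V = cubic b0 b1 b2 b3"
    unfolding assms(1) cubic_in_null_coordinates by blast
  have card: "card {1..5::nat} = 5" by simp
  have inj: "inj_on d {1..5}"
  proof (rule inj_onI, rule ccontr)
    fix i j assume ij: "i \<in> {1..5}" "j \<in> {1..5}" "d i = d j" "i \<noteq> j"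
    have "same_point (d i) (d j)"
      unfolding same_point_def ij(3) by (rule exI[of _ 1]) simp
    then show False using assms(4) ij by blast
  qed
  have nonzero: "d i \<noteq> 0" if "i \<in> {1..5}" for i
    using assms(2)[OF that] by (simp add: proper_darboux_point_def darboux_point_def)
  note sums = spectrum_sums[OF card inj nonzero assms(5)[unfolded V] assms(6)[unfolded V]]
  show ?thesis
    using sums by blast
qed

end
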